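(* The Clifford series of multiplicities $(3,4k)$ and $(7,8k)$ are just the inhomogeneous series of Takeuchi and Ozeki. That is, for every integer $k\ge1$: every Clifford isoparametric family with $(m_1,m_2)=(3,4k)$ is congruent to the Takeuchi–Ozeki family of multiplicities $(3,4k)$, and every Clifford isoparametric family with $(m_1,m_2)=(7,8k)$ is congruent to the Takeuchi–Ozeki family of multiplicities $(7,8k)$.
   Context: A (symmetric) Clifford system on $\mathbb{R}^{2l}$ is an $(m+1)$-tuple $(P_0,\dots,P_m)$ of symmetric endomorphisms of $\mathbb{R}^{2l}$ with $P_iP_j+P_jP_i=2\delta_{ij}\,\mathrm{Id}$ for all $i,j$. Put $m_1=m$, $m_2=l-m-1$. If $m_2>0$, the associated Clifford isoparametric family of multiplicities $(m_1,m_2)$ consists of the level sets $f^{-1}(c)$, $-1<c<1$, of $f=F|_{S^{2l-1}}$, where $F(x)=\langle x,x\rangle^2-2\sum_{i=0}^m\langle P_ix,x\rangle^2$. The Takeuchi–Ozeki families: let $\mathbb{F}$ be the quaternions $\mathbb{H}$ or the octonions (Cayley numbers) $\mathbb{O}$, with conjugation $a\mapsto\bar a$ and standard Euclidean structure, and let $k\ge1$. Write $u=(u_0,u_1)$, $v=(v_0,v_1)\in\mathbb{F}\oplus\mathbb{F}^k=\mathbb{F}^{k+1}$, and let $u\bar v^{t}:=\sum_j u^{(j)}\overline{v^{(j)}}\in\mathbb{F}$ be the sum over all $k+1$ coordinates $u^{(j)},v^{(j)}\in\mathbb{F}$ of $u$ and $v$. On $\mathbb{F}^{k+1}\oplus\mathbb{F}^{k+1}$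 set $$F_0(u,v)=4\bigl(\|u\bar v^{t}\|^2-\langle u,v\rangle^2\bigr)+\bigl(\|u_1\|^2-\|v_1\|^2+2\langle u_0,v_0\rangle\bigr)^2,\qquad F_{TO}(u,v)=(\|u\|^2+\|v\|^2)^2-2F_0(u,v).$$ The Takeuchi–Ozeki family consists of the level sets in the unit sphere of $F_{TO}$ with values in $(-1,1)$; it has multiplicities $(3,4k)$ for $\mathbb{F}=\mathbb{H}$ and $(7,8k)$ for $\mathbb{F}=\mathbb{O}$. Two families in a sphere are congruent if an orthogonal transformation of the ambient Euclidean spaces carries the hypersurfaces of one onto those of the other. *)

theory Defs
  imports "HOL-Analysis.Analysis"
begin

definition clifford_system :: "nat \<Rightarrow> (nat \<Rightarrow> 'a::real_inner \<Rightarrow> 'a) \<Rightarrow> bool" where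
  "clifford_system m P \<longleftrightarrow>
     (\<forall>i\<le>m. linear (P i) \<and> (\<forall>x y. P i x \<bullet> y = x \<bullet> P i y)) \<and>
     (\<forall>i\<le>m. \<forall>j\<le>m. \<forall>x. P i (P j x) + P j (P i x) = (if i = j then 2 else 0) *\<^sub>R x)"

definition level_family :: "('a::real_inner \<Rightarrow> real) \<Rightarrow> 'a set set" where
  "level_family F = {{x \<in> sphere 0 1. F x = c} | c. -1 < c \<and> c < 1}"

definition clifford_poly :: "nat \<Rightarrow> (nat \<Rightarrow> 'a::real_inner \<Rightarrow> 'a) \<Rightarrow> 'a \<Rightarrow> real" where
  "clifford_poly m P x = (x \<bullet> x)\<^sup>2 - 2 * (\<Sum>i\<le>m. (P i x \<bullet> x)\<^sup>2)"

definition clifford_isoparametric_family ::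
    "nat \<Rightarrow> nat \<Rightarrow> 'a::euclidean_space set set \<Rightarrow> bool" where
  "clifford_isoparametric_family m1 m2 \<F> \<longleftrightarrow>
     (\<exists>l P. DIM('a) = 2 * l \<and> clifford_system m1 P \<and>
        l = m1 + m2 + 1 \<and> 0 < m2 \<and> \<F> = level_family (clifford_poly m1 P))"

text \<open>Quaternions and octonions are obtained from the complex numbers by Cayley--Dickson
  doubling; the pair \<open>(a, b)\<close> of complex numbers is the quaternion \<open>a + b j\<close>.
  The product types carry the standard Euclidean structure.\<close>

type_synonym quat = "complex \<times> complex"
type_synonym oct = "quat \<times> quat"

fun quat_cnj :: "quat \<Rightarrow> quat" where
  "quat_cnj (a, b) = (cnj a, - b)"

fun quat_mult :: "quat \<Rightarrow> quat \<Rightarrow> quat" where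
  "quat_mult (a, b) (c, d) = (a * c - cnj d * b, d * a + b * cnj c)"

fun oct_cnj :: "oct \<Rightarrow> oct" where
  "oct_cnj (a, b) = (quat_cnj a, - b)"

fun oct_mult :: "oct \<Rightarrow> oct \<Rightarrow> oct" where
  "oct_mult (a, b) (c, d) =
     (quat_mult a c - quat_mult (quat_cnj d) b, quat_mult d a + quat_mult b (quat_cnj c))"

lemma quat_units:
  defines "i \<equiv> (\<i>, 0) :: quat" and "j \<equiv> (0, 1) :: quat" and "k \<equiv> (0, \<i>) :: quat"
  shows "quat_mult i i = (-1, 0)" "quat_mult j j = (-1, 0)" "quat_mult k k = (-1, 0)"
    "quat_mult i j = k" "quat_mult j k = i" "quat_mult k i = j"
  by (simp_all add: i_def j_def k_def)

lemma norm_quat_mult: "norm (quat_mult a b) = norm a * norm b"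
proof -
  have "(norm (quat_mult a b))\<^sup>2 = (norm a * norm b)\<^sup>2"
    by (cases a; cases b; simp add: power_mult_distrib norm_Pair cmod_power2)
      (simp add: power2_eq_square algebra_simps)
  then show ?thesis by simp
qed

lemma norm_oct_mult: "norm (oct_mult a b) = norm a * norm b"
proof -
  obtain a1 a2 a3 a4 where a: "a = ((a1, a2), (a3, a4))" by (metis surj_pair)
  obtain b1 b2 b3 b4 where b: "b = ((b1, b2), (b3, b4))" by (metis surj_pair)
  have "(norm (oct_mult a b))\<^sup>2 = (norm a * norm b)\<^sup>2"
    unfolding a b
    by (simp add: power_mult_distrib norm_Pair cmod_power2)
      (simp add: power2_eq_square algebra_simps)
  then show ?thesis by simp
qed

lemma oct_mult_cnj: "oct_mult a (oct_cnj a) = ((of_real ((norm a)\<^sup>2), 0), 0)"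
proof -
  obtain a1 a2 a3 a4 where a: "a = ((a1, a2), (a3, a4))" by (metis surj_pair)
  show ?thesis
    unfolding a
    by (simp add: norm_Pair cmod_power2 complex_eq_iff zero_prod_def)
      (simp add: power2_eq_square algebra_simps)
qed

text \<open>The Takeuchi--Ozeki polynomial over an algebra \<open>'f\<close> with product \<open>mul\<close> and conjugation
  \<open>cj\<close>. A vector of the direct sum of \<open>k + 1\<close> copies of \<open>'f\<close> is
  split as \<open>(u\<^sub>0, u\<^sub>1)\<close> with \<open>u\<^sub>1\<close> indexed by the finite type
  \<open>'k\<close>, so that \<open>k = CARD('k)\<close>.\<close>

definition herm_prod ::
    "('f \<Rightarrow> 'f \<Rightarrow> 'f) \<Rightarrow> ('f \<Rightarrow> 'f) \<Rightarrow> 'f \<times> ('f ^ 'k) \<Rightarrow> 'f \<times> ('f ^ 'k) \<Rightarrow> 'f::euclidean_space" where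
  "herm_prod mul cj u v =
     mul (fst u) (cj (fst v)) + (\<Sum>j\<in>UNIV. mul (snd u $ j) (cj (snd v $ j)))"

definition TO_F0 ::
    "('f::euclidean_space \<Rightarrow> 'f \<Rightarrow> 'f) \<Rightarrow> ('f \<Rightarrow> 'f) \<Rightarrow> 'f \<times> ('f ^ 'k) \<Rightarrow> 'f \<times> ('f ^ 'k) \<Rightarrow> real" where
  "TO_F0 mul cj u v =
     4 * ((norm (herm_prod mul cj u v))\<^sup>2 - (u \<bullet> v)\<^sup>2)
     + ((norm (snd u))\<^sup>2 - (norm (snd v))\<^sup>2 + 2 * (fst u \<bullet> fst v))\<^sup>2"

definition TO_poly ::
    "('f::euclidean_space \<Rightarrow> 'f \<Rightarrow> 'f) \<Rightarrow> ('f \<Rightarrow> 'f) \<Rightarrow>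
     ('f \<times> ('f ^ 'k)) \<times> ('f \<times> ('f ^ 'k)) \<Rightarrow> real" where
  "TO_poly mul cj =
     (\<lambda>(u, v). ((norm u)\<^sup>2 + (norm v)\<^sup>2)\<^sup>2 - 2 * TO_F0 mul cj u v)"

definition TO_family_quat :: "((quat \<times> (quat ^ 'k)) \<times> (quat \<times> (quat ^ 'k))) set set" where
  "TO_family_quat = level_family (TO_poly quat_mult quat_cnj)"

definition TO_family_oct :: "((oct \<times> (oct ^ 'k)) \<times> (oct \<times> (oct ^ 'k))) set set" where
  "TO_family_oct = level_family (TO_poly oct_mult oct_cnj)"

text \<open>The ambient spaces may be of different types, so \<open>orthogonal_transformation\<close>, which is
  restricted to endomorphisms, does not apply.\<close>

definition congruent_families ::
    "'a::euclidean_space set set \<Rightarrow> 'b::euclidean_space set set \<Rightarrow> bool" where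
  "congruent_families \<A> \<B> \<longleftrightarrow>
     (\<exists>T. linear T \<and> bij T \<and> (\<forall>x y. T x \<bullet> T y = x \<bullet> y) \<and> (\<lambda>M. T ` M) ` \<A> = \<B>)"

end

theory Submission
  imports Defs
begin

text \<open>For \<open>m = 3, 7\<close> the symmetric Clifford algebra on \<open>m + 1\<close> generators has a
  single irreducible module, which is \<open>F \<oplus> F\<close> with \<open>P\<^sub>0 (p, q) = (p, -q)\<close> and
  \<open>P\<^sub>a (p, q) = (e\<^sub>a q, -e\<^sub>a p)\<close> for the imaginary units \<open>e\<^sub>a\<close>. A copy of it is generated by
  any unit vector fixed by \<open>P\<^sub>0\<close> and, for the octonions, by three commuting products of four
  generators; such a vector exists in every nonzero invariant subspace. Splitting off orthogonal
  copies identifies \<open>\<real>\<^bsup>2l\<^esup>\<close> with \<open>k + 1\<close> copies of \<open>F \<oplus> F\<close>. The Takeuchi--Ozeki polynomial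
  comes from the same module, its \<open>P\<^sub>0\<close> being diagonal except for the swap of \<open>u\<^sub>0\<close> and \<open>v\<^sub>0\<close>,
  which a rotation by 45 degrees diagonalises; the remaining terms appear because
  \<open>\<parallel>h\<parallel>\<^sup>2 - (Re h)\<^sup>2\<close> is the sum of the squared imaginary coordinates of \<open>h = u v\<^sup>*\<close>.\<close>

section \<open>Frames and the algebra of Clifford systems\<close>

definition clifford_frame ::
    "nat \<Rightarrow> (nat \<Rightarrow> 'a::real_inner \<Rightarrow> 'a) \<Rightarrow> (nat \<Rightarrow> 'f::real_inner \<Rightarrow> 'f) \<Rightarrow> ('f \<times> 'f \<Rightarrow> 'a) \<Rightarrow> bool" where
  "clifford_frame m P L \<Phi> \<longleftrightarrow> linear \<Phi> \<and> (\<forall>z. norm (\<Phi> z) = norm z) \<and>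
     (\<forall>p q. P 0 (\<Phi> (p, q)) = \<Phi> (p, - q)) \<and>
     (\<forall>a\<in>{1..m}. \<forall>p q. P a (\<Phi> (p, q)) = \<Phi> (L a q, - L a p))"

text \<open>Asking for a frame inside every nonzero invariant subspace, not just somewhere in the
  space, lets the construction be repeated in the orthogonal complement of the copies already found.
  The vector \<open>y\<close> witnesses that \<open>U\<close> is nonzero.\<close>

definition admits_frames ::
    "nat \<Rightarrow> (nat \<Rightarrow> 'a::real_inner \<Rightarrow> 'a) \<Rightarrow> (nat \<Rightarrow> 'f::real_inner \<Rightarrow> 'f) \<Rightarrow> bool" where
  "admits_frames m P L \<longleftrightarrow>
     (\<forall>U y. subspace U \<longrightarrow> (\<forall>a\<le>m. P a ` U \<subseteq> U) \<longrightarrow> y \<in> U \<longrightarrow> y \<noteq> 0 \<longrightarrow>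
        (\<exists>\<Phi>. clifford_frame m P L \<Phi> \<and> range \<Phi> \<subseteq> U))"

lemma inner_linear_isometry:
  fixes f :: "'a::real_inner \<Rightarrow> 'b::real_inner"
  assumes "linear f" and "\<And>z. norm (f z) = norm z"
  shows "f z \<bullet> f w = z \<bullet> w"
proof -
  have "f z \<bullet> f w = ((norm (f (z + w)))\<^sup>2 - (norm (f z))\<^sup>2 - (norm (f w))\<^sup>2) / 2"
    by (simp add: linear_add[OF assms(1)] power2_norm_eq_inner inner_simps inner_commute)
  also have "\<dots> = z \<bullet> w"
    by (simp add: assms(2)) (simp add: power2_norm_eq_inner inner_simps inner_commute)
  finally show ?thesis .
qed

text \<open>The vector \<open>y + S y\<close> is always fixed by \<open>S\<close>. If it vanishes,
  \<open>y\<close> lies in the (-1)-eigenspace, and \<open>R\<close>, which anticommutes with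
  \<open>S\<close>, moves it injectively into the (+1)-eigenspace.\<close>

lemma involution_fixed_vector:
  fixes S R :: "'a::real_vector \<Rightarrow> 'a"
  assumes S: "linear S" "\<And>x. S (S x) = x" and R: "linear R" "inj R"
    and SR: "\<And>x. S (R x) = - R (S x)"
    and W: "subspace W" "S ` W \<subseteq> W" "R ` W \<subseteq> W" and y: "y \<in> W" "y \<noteq> 0"
  obtains z where "z \<in> W" "z \<noteq> 0" "S z = z"
proof (cases "y + S y = 0")
  case False
  show thesis
  proof
    show "y + S y \<in> W" using W y by (auto intro: subspace_add)
    show "S (y + S y) = y + S y" by (simp add: linear_add[OF S(1)] S(2))
  qed fact
next
  case True
  then have "S y = - y" by (simp add: eq_neg_iff_add_eq_0 add.commute)
  then have "S (R y) = R y" by (simp add: SR linear_neg[OF R(1)])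
  moreover have "R y \<noteq> 0" using R y by (metis injD linear_0)
  moreover have "R y \<in> W" using W y by auto
  ultimately show thesis by (intro that)
qed

context
  fixes m :: nat and P :: "nat \<Rightarrow> 'a::real_inner \<Rightarrow> 'a"
  assumes sys: "clifford_system m P"
begin

lemma clifford_linear: "i \<le> m \<Longrightarrow> linear (P i)"
  using sys by (simp add: clifford_system_def)

lemma clifford_symmetric: "i \<le> m \<Longrightarrow> P i x \<bullet> y = x \<bullet> P i y"
  using sys by (simp add: clifford_system_def)

lemma clifford_involution: "i \<le> m \<Longrightarrow> P i (P i x) = x"
  using sys by (fastforce simp: clifford_system_def scaleR_2 simp flip: scaleR_2)

lemma clifford_swap: "j < i \<Longrightarrow> i \<le> m \<Longrightarrow> P i (P j x) = - P j (P i x)"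
  using sys by (auto simp: clifford_system_def eq_neg_iff_add_eq_0)

lemmas clifford_linear_simps =
  linear_add[OF clifford_linear] linear_diff[OF clifford_linear] linear_neg[OF clifford_linear]
  linear_0[OF clifford_linear] linear_scale[OF clifford_linear]

lemma clifford_inner_self:
  assumes "i \<le> m" shows "P i x \<bullet> P i y = x \<bullet> y"
  by (simp add: clifford_symmetric clifford_involution assms)

lemma clifford_inj: "i \<le> m \<Longrightarrow> inj (P i)"
  by (metis clifford_involution injI)


lemma clifford_swap0: "0 < i \<Longrightarrow> i \<le> m \<Longrightarrow> P 0 (P i x) = - P i (P 0 x)"
  using clifford_swap[of 0 i x] by simp

text \<open>Insert \<open>P 0\<close> in front of \<open>x\<close> and move it across by symmetry:
  it passes an odd number of generators before \<open>x\<close> absorbs it, which flips the sign.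
  \<open>clifford_inner_3\<close> rests on the same argument.\<close>

lemma clifford_inner_1:
  assumes "P 0 x = x" "0 < i" "i \<le> m"
  shows "x \<bullet> P i x = 0"
proof -
  have "x \<bullet> P i x = P 0 x \<bullet> P i x" by (simp add: assms)
  also have "\<dots> = - (x \<bullet> P i x)"
    by (subst clifford_symmetric) (simp_all add: clifford_swap0 assms)
  finally show ?thesis by simp
qed

text \<open>Symmetry reverses the order of the factors and anticommutation restores it with a sign,
  so a product of two distinct generators is skew-adjoint.\<close>

lemma clifford_inner_2:
  assumes "i < j" "j \<le> m"
  shows "x \<bullet> P i (P j x) = 0"
proof -
  have "x \<bullet> P i (P j x) = P j (P i x) \<bullet> x"
    using assms by (simp add: clifford_symmetric)
  also have "\<dots> = - (x \<bullet> P i (P j x))"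
    using assms by (simp add: clifford_swap inner_commute)
  finally show ?thesis by simp
qed

lemma clifford_inner_3:
  assumes "P 0 x = x" "0 < i" "0 < j" "0 < k" "i \<le> m" "j \<le> m" "k \<le> m"
  shows "x \<bullet> P i (P j (P k x)) = 0"
proof -
  have "x \<bullet> P i (P j (P k x)) = P 0 x \<bullet> P i (P j (P k x))" by (simp add: assms)
  also have "\<dots> = - (x \<bullet> P i (P j (P k x)))"
    by (subst clifford_symmetric) (simp_all add: clifford_swap0 clifford_linear_simps assms)
  finally show ?thesis by simp
qed

end

section \<open>Frames over the quaternions\<close>

definition quat_unit :: "nat \<Rightarrow> quat" where
  "quat_unit a = [(1, 0), (\<i>, 0), (0, 1), (0, \<i>)] ! a"

lemma atLeastAtMost_1_3: "{1..3::nat} = {1, 2, 3}"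
  by auto

lemma atLeastAtMost_1_7: "{1..7::nat} = {1, 2, 3, 4, 5, 6, 7}"
  by auto

lemma admits_frames_quat:
  assumes sys: "clifford_system 3 P"
  shows "admits_frames 3 P (\<lambda>a. quat_mult (quat_unit a))"
  unfolding admits_frames_def
proof (intro allI impI)
  fix U :: "'a set" and y
  assume U: "subspace U" "\<forall>a\<le>3. P a ` U \<subseteq> U" and y: "y \<in> U" "y \<noteq> 0"
  note inv = clifford_involution[OF sys] and lin = clifford_linear[OF sys]
    and lin_simps = clifford_linear_simps[OF sys]
  have PU: "a \<le> 3 \<Longrightarrow> v \<in> U \<Longrightarrow> P a v \<in> U" for a v using U(2) by blast
  obtain z where z: "z \<in> U" "z \<noteq> 0" "P 0 z = z"
    by (rule involution_fixed_vector[of "P 0" "P 1" U y])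
      (use U y lin inv clifford_inj[OF sys] clifford_swap0[OF sys] in simp_all)
  define x where "x = (1 / norm z) *\<^sub>R z"
  have x: "x \<in> U" "P 0 x = x" "x \<bullet> x = 1"
    using z U(1) by (simp_all add: x_def subspace_scale lin_simps dot_square_norm power2_eq_square)
  \<comment> \<open>Rewriting moves \<open>P 0\<close> inward until it meets \<open>x\<close>, and
    sorts the other generators by increasing index. Restricting the smaller index to
    \<open>Suc n\<close> or a numeral keeps it positive; with index 0 allowed, the two rules would
    undo each other.\<close>
  note swap = clifford_swap0[OF sys] clifford_swap[OF sys, of "Suc n" for n]
     clifford_swap[OF sys, of "numeral n" for n]
  note P_simps = inv swap lin_simps x(2)
  note inner_zero = clifford_inner_1[OF sys x(2)] clifford_inner_2[OF sys]
    clifford_inner_3[OF sys x(2)]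
  txt \<open>The coefficients are forced by the intertwining relations and \<open>\<Phi> (1, 0) = x\<close>:
    \<open>\<Phi> (0, e\<^sub>a) = - P\<^sub>a x\<close> and \<open>\<Phi> (e\<^sub>a e\<^sub>b, 0) = - P\<^sub>a P\<^sub>b x\<close>.\<close>
  define \<Phi> :: "quat \<times> quat \<Rightarrow> 'a" where "\<Phi> = (\<lambda>(p, q).
      Re (fst p) *\<^sub>R x - Im (fst p) *\<^sub>R P 2 (P 3 x)
      + Re (snd p) *\<^sub>R P 1 (P 3 x) - Im (snd p) *\<^sub>R P 1 (P 2 x)
      - Re (fst q) *\<^sub>R P 1 (P 2 (P 3 x)) - Im (fst q) *\<^sub>R P 1 x
      - Re (snd q) *\<^sub>R P 2 x - Im (snd q) *\<^sub>R P 3 x)"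
  have "linear \<Phi>"
    by (rule linearI) (auto simp: \<Phi>_def algebra_simps)
  moreover have "norm (\<Phi> w) = norm w" for w
  proof -
    obtain a b c d where w: "w = ((a, b), (c, d))" by (metis surj_pair)
    \<comment> \<open>Each inner product of two coefficient vectors becomes that of \<open>x\<close>
      with a sorted word in \<open>P 1\<close>, \<open>P 2\<close>, \<open>P 3\<close> applied to
      \<open>x\<close>. The words of length 1, 2, 3 contribute 0 and the empty word 1, so the
      coefficient vectors are orthonormal.\<close>
    have "(norm (\<Phi> w))\<^sup>2 = (norm w)\<^sup>2"
      unfolding power2_norm_eq_inner
      by (simp add: w \<Phi>_def inner_simps clifford_symmetric[OF sys] P_simps x(3) inner_zero inner_complex_def)
    then show ?thesis by simp
  qed
  moreover have "P 0 (\<Phi> (p, q)) = \<Phi> (p, - q)" for p q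
    by (cases p; cases q) (simp add: \<Phi>_def P_simps)
  moreover have "P a (\<Phi> (p, q)) = \<Phi> (quat_mult (quat_unit a) q, - quat_mult (quat_unit a) p)"
    if "a \<in> {1..3}" for a p q
    using that unfolding atLeastAtMost_1_3
    by (cases p; cases q) (auto simp: \<Phi>_def P_simps quat_unit_def)
  moreover have "range \<Phi> \<subseteq> U"
    by (auto simp: \<Phi>_def x(1) U(1) PU subspace_add subspace_diff subspace_scale)
  ultimately show "\<exists>\<Phi>. clifford_frame 3 P (\<lambda>a. quat_mult (quat_unit a)) \<Phi> \<and> range \<Phi> \<subseteq> U"
    unfolding clifford_frame_def by blast
qed


section \<open>Frames over the octonions\<close>

text \<open>Applying two of the four generators to the relation cancels them on the left and leaves
  an identity between complementary pairs; the sign counts the transpositions. The pair containing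
  the smallest index always ends up on the right, as the target of rewriting.\<close>

lemma clifford_quadruple:
  assumes sys: "clifford_system m P" and w: "P a (P b (P c (P d x))) = s *\<^sub>R x"
    and lt: "a < b" "b < c" "c < d" "d \<le> m"
  shows "P c (P d x) = - (s *\<^sub>R P a (P b x))" "P b (P d x) = s *\<^sub>R P a (P c x)"
    "P b (P c x) = - (s *\<^sub>R P a (P d x))"
proof -
  have le: "a \<le> m" "b \<le> m" "c \<le> m" "a < c" "a < d" "b < d" using lt by linarith+
  note simps = clifford_involution[OF sys] clifford_linear_simps[OF sys]
  note swap = clifford_swap[OF sys]
  have "P b (P a (P a (P b (P c (P d x))))) = s *\<^sub>R P b (P a x)"
    by (simp only: w simps le)
  then show "P c (P d x) = - (s *\<^sub>R P a (P b x))"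
    by (simp add: simps lt le swap[of a b])
  have "P c (P a (P a (P b (P c (P d x))))) = s *\<^sub>R P c (P a x)"
    by (simp only: w simps le)
  then show "P b (P d x) = s *\<^sub>R P a (P c x)"
    by (simp add: simps lt le swap[of a c] swap[of b c])
  have "P d (P a (P a (P b (P c (P d x))))) = s *\<^sub>R P d (P a x)"
    by (simp only: w simps le lt)
  then show "P b (P c x) = - (s *\<^sub>R P a (P d x))"
    by (simp add: simps lt le swap[of a d] swap[of b d] swap[of c d])
qed

definition oct_unit :: "nat \<Rightarrow> oct" where
  "oct_unit a = [((1, 0), 0), ((\<i>, 0), 0), ((0, 1), 0), ((0, \<i>), 0),
     (0, (1, 0)), (0, (\<i>, 0)), (0, (0, 1)), (0, (0, \<i>))] ! a"

text \<open>The index sets \<open>4567\<close>, \<open>2367\<close>, \<open>1357\<close> are complements of lines of the Fano plane of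
  \<open>oct_mult\<close>; the corresponding products of left multiplications fix the octonion 1. Each
  eigenvalue can be made \<open>+1\<close> by an operator that anticommutes with the product in question and
  commutes with the earlier ones: \<open>P\<^sub>4\<close>, \<open>P\<^sub>2\<close>, \<open>P\<^sub>1\<close>, and \<open>P\<^sub>1 P\<^sub>2 P\<^sub>3\<close> for \<open>P\<^sub>0\<close>.\<close>
lemma octonion_stabilised_vector:
  assumes sys: "clifford_system 7 P" and U: "subspace U" "\<forall>a\<le>7. P a ` U \<subseteq> U"
    and y: "y \<in> U" "y \<noteq> 0"
  obtains x where "x \<in> U" "norm x = 1" "P 0 x = x" "P 4 (P 5 (P 6 (P 7 x))) = x"
    "P 2 (P 3 (P 6 (P 7 x))) = x" "P 1 (P 3 (P 5 (P 7 x))) = x"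
proof -
  note swap = clifford_swap0[OF sys] clifford_swap[OF sys, of "Suc n" for n]
     clifford_swap[OF sys, of "numeral n" for n]
  note P_simps = clifford_involution[OF sys] swap clifford_linear_simps[OF sys]
  have PU: "a \<le> 7 \<Longrightarrow> v \<in> U \<Longrightarrow> P a v \<in> U" for a v using U(2) by blast
  have inj: "inj (P a)" if "a \<le> 7" for a using clifford_inj[OF sys that] .
  define S\<^sub>1 where "S\<^sub>1 v = P 4 (P 5 (P 6 (P 7 v)))" for v
  define S\<^sub>2 where "S\<^sub>2 v = P 2 (P 3 (P 6 (P 7 v)))" for v
  define S\<^sub>3 where "S\<^sub>3 v = P 1 (P 3 (P 5 (P 7 v)))" for v
  define R where "R v = P 1 (P 2 (P 3 v))" for v
  note defs = S\<^sub>1_def S\<^sub>2_def S\<^sub>3_def R_def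
  have lin: "linear (P a)" if "a \<le> 7" for a using clifford_linear[OF sys that] .
  have lins: "linear S\<^sub>1" "linear S\<^sub>2" "linear S\<^sub>3" "linear R"
    by (auto simp: defs P_simps intro!: linearI)
  have invol: "S\<^sub>1 (S\<^sub>1 v) = v" "S\<^sub>2 (S\<^sub>2 v) = v" "S\<^sub>3 (S\<^sub>3 v) = v" "R (R v) = - v" for v
    by (simp_all add: defs P_simps)
  have "inj R" by (rule injI) (metis invol(4) neg_equal_iff_equal)
  define U\<^sub>1 where "U\<^sub>1 = {v \<in> U. S\<^sub>1 v = v}"
  define U\<^sub>2 where "U\<^sub>2 = {v \<in> U\<^sub>1. S\<^sub>2 v = v}"
  define U\<^sub>3 where "U\<^sub>3 = {v \<in> U\<^sub>2. S\<^sub>3 v = v}"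
  have sub: "subspace U\<^sub>1" "subspace U\<^sub>2" "subspace U\<^sub>3"
    using U(1) by (auto simp: U\<^sub>1_def U\<^sub>2_def U\<^sub>3_def subspace_def linear_0 linear_add linear_scale lins)
  obtain y\<^sub>1 where "y\<^sub>1 \<in> U" "y\<^sub>1 \<noteq> 0" "S\<^sub>1 y\<^sub>1 = y\<^sub>1"
  proof (rule involution_fixed_vector[of S\<^sub>1 "P 4" U y])
    show "S\<^sub>1 (P 4 v) = - P 4 (S\<^sub>1 v)" for v by (simp add: defs P_simps)
    show "S\<^sub>1 ` U \<subseteq> U" by (auto simp: defs PU)
  qed (use U y lins invol lin inj in simp_all)
  then have y\<^sub>1: "y\<^sub>1 \<in> U\<^sub>1" "y\<^sub>1 \<noteq> 0" by (simp_all add: U\<^sub>1_def)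
  obtain y\<^sub>2 where "y\<^sub>2 \<in> U\<^sub>1" "y\<^sub>2 \<noteq> 0" "S\<^sub>2 y\<^sub>2 = y\<^sub>2"
  proof (rule involution_fixed_vector[of S\<^sub>2 "P 2" U\<^sub>1 y\<^sub>1])
    show "S\<^sub>2 (P 2 v) = - P 2 (S\<^sub>2 v)" for v by (simp add: defs P_simps)
    have "S\<^sub>1 (S\<^sub>2 v) = S\<^sub>2 (S\<^sub>1 v)" for v by (simp add: defs P_simps)
    then show "S\<^sub>2 ` U\<^sub>1 \<subseteq> U\<^sub>1" by (auto simp: U\<^sub>1_def) (simp add: defs PU)
    have "S\<^sub>1 (P 2 v) = P 2 (S\<^sub>1 v)" for v by (simp add: defs P_simps)
    then show "P 2 ` U\<^sub>1 \<subseteq> U\<^sub>1" by (auto simp: U\<^sub>1_def PU)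
  qed (use sub y\<^sub>1 lins invol lin inj in simp_all)
  then have y\<^sub>2: "y\<^sub>2 \<in> U\<^sub>2" "y\<^sub>2 \<noteq> 0" by (simp_all add: U\<^sub>2_def)
  obtain y\<^sub>3 where "y\<^sub>3 \<in> U\<^sub>2" "y\<^sub>3 \<noteq> 0" "S\<^sub>3 y\<^sub>3 = y\<^sub>3"
  proof (rule involution_fixed_vector[of S\<^sub>3 "P 1" U\<^sub>2 y\<^sub>2])
    show "S\<^sub>3 (P 1 v) = - P 1 (S\<^sub>3 v)" for v by (simp add: defs P_simps)
    have "S\<^sub>1 (S\<^sub>3 v) = S\<^sub>3 (S\<^sub>1 v)" "S\<^sub>2 (S\<^sub>3 v) = S\<^sub>3 (S\<^sub>2 v)" for v
      by (simp_all add: defs P_simps)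
    then show "S\<^sub>3 ` U\<^sub>2 \<subseteq> U\<^sub>2" by (auto simp: U\<^sub>1_def U\<^sub>2_def) (simp add: defs PU)
    have "S\<^sub>1 (P 1 v) = P 1 (S\<^sub>1 v)" "S\<^sub>2 (P 1 v) = P 1 (S\<^sub>2 v)" for v
      by (simp_all add: defs P_simps)
    then show "P 1 ` U\<^sub>2 \<subseteq> U\<^sub>2" by (auto simp: U\<^sub>1_def U\<^sub>2_def PU)
  qed (use sub y\<^sub>2 lins invol lin inj in simp_all)
  then have y\<^sub>3: "y\<^sub>3 \<in> U\<^sub>3" "y\<^sub>3 \<noteq> 0" by (simp_all add: U\<^sub>3_def)
  \<comment> \<open>Each of \<open>P 1\<close>, ..., \<open>P 7\<close> anticommutes with at least
    one of the three products, so no single generator can change the sign of \<open>P 0\<close>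
    within \<open>U\<^sub>3\<close>. The product \<open>R\<close> meets each of the three index sets
    in 0 or 2 elements and therefore commutes with all three.\<close>
  obtain z where z: "z \<in> U\<^sub>3" "z \<noteq> 0" "P 0 z = z"
  proof (rule involution_fixed_vector[of "P 0" R U\<^sub>3 y\<^sub>3])
    show "P 0 (R v) = - R (P 0 v)" for v by (simp add: defs P_simps)
    have "S\<^sub>1 (P 0 v) = P 0 (S\<^sub>1 v)" "S\<^sub>2 (P 0 v) = P 0 (S\<^sub>2 v)" "S\<^sub>3 (P 0 v) = P 0 (S\<^sub>3 v)" for v
      by (simp_all add: defs P_simps)
    then show "P 0 ` U\<^sub>3 \<subseteq> U\<^sub>3" by (auto simp: U\<^sub>1_def U\<^sub>2_def U\<^sub>3_def PU)
    have "S\<^sub>1 (R v) = R (S\<^sub>1 v)" "S\<^sub>2 (R v) = R (S\<^sub>2 v)" "S\<^sub>3 (R v) = R (S\<^sub>3 v)" for v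
      by (simp_all add: defs P_simps)
    then show "R ` U\<^sub>3 \<subseteq> U\<^sub>3" by (auto simp: U\<^sub>1_def U\<^sub>2_def U\<^sub>3_def) (simp add: defs PU)
  qed (use sub y\<^sub>3 lins lin \<open>inj R\<close> clifford_involution[OF sys] in simp_all)
  show thesis
  proof (rule that[of "(1 / norm z) *\<^sub>R z"])
    show "(1 / norm z) *\<^sub>R z \<in> U"
      using z U(1) by (simp add: U\<^sub>1_def U\<^sub>2_def U\<^sub>3_def subspace_scale)
  qed (use z in \<open>simp_all add: U\<^sub>1_def U\<^sub>2_def U\<^sub>3_def S\<^sub>1_def S\<^sub>2_def S\<^sub>3_def clifford_linear_simps[OF sys]\<close>)
qed

lemma admits_frames_oct:
  assumes sys: "clifford_system 7 P"
  shows "admits_frames 7 P (\<lambda>a. oct_mult (oct_unit a))"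
  unfolding admits_frames_def
proof (intro allI impI)
  fix U :: "'a set" and y
  assume U: "subspace U" "\<forall>a\<le>7. P a ` U \<subseteq> U" and y: "y \<in> U" "y \<noteq> 0"
  have PU: "a \<le> 7 \<Longrightarrow> v \<in> U \<Longrightarrow> P a v \<in> U" for a v using U(2) by blast
  obtain x where x: "x \<in> U" "norm x = 1" "P 0 x = x"
    and w1: "P 4 (P 5 (P 6 (P 7 x))) = x" and w2: "P 2 (P 3 (P 6 (P 7 x))) = x"
    and w3: "P 1 (P 3 (P 5 (P 7 x))) = x"
    by (rule octonion_stabilised_vector[OF sys U y])
  have xx: "x \<bullet> x = 1" using x(2) by (simp add: dot_square_norm)
  note swap = clifford_swap0[OF sys] clifford_swap[OF sys, of "Suc n" for n]
     clifford_swap[OF sys, of "numeral n" for n]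
  note P_simps = clifford_involution[OF sys] swap clifford_linear_simps[OF sys] x(3)
  \<comment> \<open>Composing stabilising products takes the symmetric difference of their index
    sets, up to sign. This yields the other four complements of Fano lines: 2345, 1346, 1256 and
    1247.\<close>
  have "P 4 (P 5 (P 6 (P 7 (P 2 (P 3 (P 6 (P 7 x))))))) = x"
    by (simp only: w1 w2)
  then have "- P 2 (P 3 (P 4 (P 5 x))) = x"
    by (simp add: P_simps)
  then have w4: "P 2 (P 3 (P 4 (P 5 x))) = - x"
    by (metis minus_minus)
  have "P 4 (P 5 (P 6 (P 7 (P 1 (P 3 (P 5 (P 7 x))))))) = x"
    by (simp only: w1 w3)
  then have w5: "P 1 (P 3 (P 4 (P 6 x))) = x"
    by (simp add: P_simps)
  have "P 2 (P 3 (P 6 (P 7 (P 1 (P 3 (P 5 (P 7 x))))))) = x"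
    by (simp only: w2 w3)
  then have w6: "P 1 (P 2 (P 5 (P 6 x))) = x"
    by (simp add: P_simps)
  have "P 2 (P 3 (P 4 (P 5 (P 1 (P 3 (P 5 (P 7 x))))))) = - x"
    by (simp only: w4 w3)
  then have w7: "P 1 (P 2 (P 4 (P 7 x))) = - x"
    by (simp add: P_simps)
  txt \<open>The \<open>1 *\<^sub>R\<close> makes the equations match the premise of \<open>clifford_quadruple\<close>.\<close>
  have "P 2 (P 3 (P 6 (P 7 x))) = 1 *\<^sub>R x" "P 1 (P 3 (P 5 (P 7 x))) = 1 *\<^sub>R x"
    "P 2 (P 3 (P 4 (P 5 x))) = (-1) *\<^sub>R x" "P 1 (P 3 (P 4 (P 6 x))) = 1 *\<^sub>R x"
    "P 1 (P 2 (P 5 (P 6 x))) = 1 *\<^sub>R x" "P 1 (P 2 (P 4 (P 7 x))) = (-1) *\<^sub>R x"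
    using w2 w3 w4 w5 w6 w7 by simp_all
  note quad = this[THEN clifford_quadruple(1)[OF sys], simplified]
    this[THEN clifford_quadruple(2)[OF sys], simplified]
    this[THEN clifford_quadruple(3)[OF sys], simplified]
  txt \<open>Oriented so that, with anticommutation, rewriting brings every word applied to \<open>x\<close>
    to one of 16 normal forms up to sign.\<close>
  have pairs: "P 4 (P 5 x) = P 2 (P 3 x)" "P 6 (P 7 x) = - P 2 (P 3 x)"
    "P 4 (P 6 x) = - P 1 (P 3 x)" "P 5 (P 7 x) = - P 1 (P 3 x)"
    "P 4 (P 7 x) = P 1 (P 2 x)" "P 5 (P 6 x) = - P 1 (P 2 x)"
    "P 2 (P 6 x) = P 1 (P 5 x)" "P 3 (P 7 x) = P 1 (P 5 x)"
    "P 2 (P 7 x) = - P 1 (P 4 x)" "P 3 (P 6 x) = P 1 (P 4 x)"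
    "P 2 (P 4 x) = P 1 (P 7 x)" "P 3 (P 5 x) = - P 1 (P 7 x)"
    "P 2 (P 5 x) = - P 1 (P 6 x)" "P 3 (P 4 x) = - P 1 (P 6 x)"
    unfolding One_nat_def by (rule quad)+
  \<comment> \<open>The coefficients are forced as for the quaternions. The value at (0, 1) is
    \<open>P 1\<close> applied to the value \<open>- P 2 (P 3 x)\<close> at (e_1, 0), because -e_1
    e_1 = 1.\<close>
  define \<Phi> :: "oct \<times> oct \<Rightarrow> 'a" where "\<Phi> = (\<lambda>(p, q).
      Re (fst (fst p)) *\<^sub>R x - Im (fst (fst p)) *\<^sub>R P 2 (P 3 x)
      + Re (snd (fst p)) *\<^sub>R P 1 (P 3 x) - Im (snd (fst p)) *\<^sub>R P 1 (P 2 x)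
      + Re (fst (snd p)) *\<^sub>R P 1 (P 5 x) - Im (fst (snd p)) *\<^sub>R P 1 (P 4 x)
      - Re (snd (snd p)) *\<^sub>R P 1 (P 7 x) + Im (snd (snd p)) *\<^sub>R P 1 (P 6 x)
      - Re (fst (fst q)) *\<^sub>R P 1 (P 2 (P 3 x)) - Im (fst (fst q)) *\<^sub>R P 1 x
      - Re (snd (fst q)) *\<^sub>R P 2 x - Im (snd (fst q)) *\<^sub>R P 3 x
      - Re (fst (snd q)) *\<^sub>R P 4 x - Im (fst (snd q)) *\<^sub>R P 5 x
      - Re (snd (snd q)) *\<^sub>R P 6 x - Im (snd (snd q)) *\<^sub>R P 7 x)"
  have "linear \<Phi>"
    by (rule linearI) (auto simp: \<Phi>_def algebra_simps)
  moreover have P0: "P 0 (\<Phi> (p, q)) = \<Phi> (p, - q)" for p q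
    by (simp add: \<Phi>_def P_simps)
  moreover have Pa: "P a (\<Phi> (p, q)) = \<Phi> (oct_mult (oct_unit a) q, - oct_mult (oct_unit a) p)"
    if "a \<in> {1..7}" for a p q
  proof -
    obtain a1 a2 a3 a4 b1 b2 b3 b4 where "p = ((a1, a2), (a3, a4))" "q = ((b1, b2), (b3, b4))"
      by (metis surj_pair)
    with that show ?thesis unfolding atLeastAtMost_1_7
      by (auto simp: \<Phi>_def P_simps pairs oct_unit_def zero_prod_def)
  qed
  \<comment> \<open>Only the first block is expanded in coordinates. The isometry \<open>P 1\<close>
    carries the second block to the first, with left multiplication by a unit octonion preserving
    norms; the two blocks are orthogonal as eigenspaces of \<open>P 0\<close> for different
    eigenvalues.\<close>
  moreover have "norm (\<Phi> w) = norm w" for w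
  proof -
    have fst: "\<Phi> (p, 0) \<bullet> \<Phi> (p, 0) = p \<bullet> p" for p
    proof -
      obtain a1 a2 a3 a4 where p: "p = ((a1, a2), (a3, a4))"
        by (metis surj_pair)
      show ?thesis
        by (simp add: p \<Phi>_def inner_simps clifford_symmetric[OF sys] P_simps pairs xx
            clifford_inner_2[OF sys] inner_complex_def)
    qed
    have snd: "\<Phi> (0, q) \<bullet> \<Phi> (0, q) = q \<bullet> q" for q
    proof -
      have "oct_mult (oct_unit 1) 0 = 0"
        by (simp add: oct_unit_def zero_prod_def)
      then have "P 1 (\<Phi> (0, q)) = \<Phi> (oct_mult (oct_unit 1) q, 0)"
        by (simp add: Pa)
      then have "\<Phi> (0, q) \<bullet> \<Phi> (0, q) = (norm (oct_mult (oct_unit 1) q))\<^sup>2"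
        using clifford_inner_self[OF sys, of 1 "\<Phi> (0, q)" "\<Phi> (0, q)"]
        by (simp add: fst power2_norm_eq_inner)
      then show ?thesis
        by (simp add: norm_oct_mult oct_unit_def norm_Pair power2_norm_eq_inner)
    qed
    have cross: "\<Phi> (p, 0) \<bullet> \<Phi> (0, q) = 0" for p q
    proof -
      have "\<Phi> (p, 0) \<bullet> \<Phi> (0, q) = P 0 (\<Phi> (p, 0)) \<bullet> P 0 (\<Phi> (0, q))"
        by (simp add: clifford_inner_self[OF sys])
      also have "\<dots> = - (\<Phi> (p, 0) \<bullet> \<Phi> (0, q))"
        using linear_neg[OF \<open>linear \<Phi>\<close>, of "(0, q)"] by (simp add: P0)
      finally show ?thesis by simp
    qed
    obtain p q where "w = (p, q)" by (cases w)
    then have "\<Phi> w = \<Phi> (p, 0) + \<Phi> (0, q)" "w \<bullet> w = p \<bullet> p + q \<bullet> q"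
      by (simp_all flip: linear_add[OF \<open>linear \<Phi>\<close>])
    then have "\<Phi> w \<bullet> \<Phi> w = w \<bullet> w"
      using cross[of p q] by (simp add: inner_add_left inner_add_right fst snd inner_commute)
    then show ?thesis by (simp add: norm_eq_sqrt_inner)
  qed
  moreover have "range \<Phi> \<subseteq> U"
    by (auto simp: \<Phi>_def x(1) U(1) PU subspace_add subspace_diff subspace_scale)
  ultimately show "\<exists>\<Phi>. clifford_frame 7 P (\<lambda>a. oct_mult (oct_unit a)) \<Phi> \<and> range \<Phi> \<subseteq> U"
    unfolding clifford_frame_def by blast
qed

section \<open>Splitting off orthogonal copies of the irreducible module\<close>

text \<open>Induction on the number of copies. The orthogonal complement \<open>U\<close> of the
  copies found so far is invariant, because the generators are symmetric and preserve each copy, and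
  it is nonzero by dimension, so it contains another copy.\<close>

lemma orthogonal_frames:
  fixes P :: "nat \<Rightarrow> 'a::euclidean_space \<Rightarrow> 'a" and L :: "nat \<Rightarrow> 'f::euclidean_space \<Rightarrow> 'f"
  assumes sys: "clifford_system m P" and adm: "admits_frames m P L"
    and "finite I" and "2 * DIM('f) * card I \<le> DIM('a)"
  shows "\<exists>\<Phi>. (\<forall>i\<in>I. clifford_frame m P L (\<Phi> i)) \<and>
           (\<forall>i\<in>I. \<forall>j\<in>I. i \<noteq> j \<longrightarrow> (\<forall>z w. \<Phi> i z \<bullet> \<Phi> j w = 0))"
  using assms(3,4)
proof (induction I rule: finite_induct)
  case empty
  then show ?case by simp
next
  case (insert i I)
  then have "2 * DIM('f) * card I \<le> DIM('a)"
    by simp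
  from insert.IH[OF this] obtain \<Phi> where \<Phi>: "\<And>i. i \<in> I \<Longrightarrow> clifford_frame m P L (\<Phi> i)"
      "\<And>i j z w. i \<in> I \<Longrightarrow> j \<in> I \<Longrightarrow> i \<noteq> j \<Longrightarrow> \<Phi> i z \<bullet> \<Phi> j w = 0"
    by metis
  define U where "U = {y. \<forall>i\<in>I. \<forall>z. y \<bullet> \<Phi> i z = 0}"
  have U: "subspace U"
    by (auto simp: U_def subspace_def inner_simps)
  have PU: "P a ` U \<subseteq> U" if "a \<le> m" for a
  proof -
    have "P a v \<bullet> \<Phi> i (p, q) = 0" if "v \<in> U" "i \<in> I" for v i p q
    proof -
      have "\<exists>z. P a (\<Phi> i (p, q)) = \<Phi> i z"
        using \<Phi>(1)[OF \<open>i \<in> I\<close>] \<open>a \<le> m\<close> unfolding clifford_frame_def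
        by (cases "a = 0") (auto simp: Suc_le_eq)
      then show ?thesis
        using that by (auto simp: clifford_symmetric[OF sys \<open>a \<le> m\<close>] U_def)
    qed
    then show ?thesis by (auto simp: U_def)
  qed
  define B where "B = (\<Union>i\<in>I. \<Phi> i ` Basis)"
  have "dim B \<le> card B"
    using insert.hyps by (intro dim_le_card span_superset) (auto simp: B_def)
  also have "\<dots> \<le> (\<Sum>i\<in>I. card (\<Phi> i ` Basis))"
    unfolding B_def using insert.hyps by (intro card_UN_le)
  also have "\<dots> \<le> (\<Sum>i\<in>I. 2 * DIM('f))"
  proof (rule sum_mono)
    fix i
    have "card (\<Phi> i ` Basis) \<le> DIM('f \<times> 'f)" by (rule card_image_le) simp
    then show "card (\<Phi> i ` Basis) \<le> 2 * DIM('f)" by simp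
  qed
  \<comment> \<open>Strict because the dimension bound also makes room for the new index
    \<open>i\<close>.\<close>
  also have "\<dots> < DIM('a)"
    using insert by (simp add: algebra_simps) (use DIM_positive[where 'a='f] in linarith)
  finally obtain y where y: "y \<noteq> 0" "\<And>v. v \<in> span B \<Longrightarrow> orthogonal y v"
    using orthogonal_to_subspace_exists by blast
  have "y \<in> U"
  proof -
    have "y \<bullet> \<Phi> i z = 0" if "i \<in> I" for i z
    proof -
      have "\<Phi> i z \<in> \<Phi> i ` span Basis" by simp
      also have "\<dots> = span (\<Phi> i ` Basis)"
        using \<Phi>(1)[OF that] by (simp add: clifford_frame_def linear_span_image)
      also have "\<dots> \<subseteq> span B"
        using that by (intro span_mono) (auto simp: B_def)
      finally show ?thesis using y(2) by (simp add: orthogonal_def)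
    qed
    then show ?thesis by (simp add: U_def)
  qed
  then obtain \<Psi> where \<Psi>: "clifford_frame m P L \<Psi>" "range \<Psi> \<subseteq> U"
    using adm U PU y(1) unfolding admits_frames_def by meson
  then have orth: "\<Psi> z \<bullet> \<Phi> j w = 0" if "j \<in> I" for j z w
    using that \<Psi>(2) unfolding U_def by blast
  then have orth': "\<Phi> j w \<bullet> \<Psi> z = 0" if "j \<in> I" for j z w
    using that by (metis inner_commute)
  show ?case
  proof (intro exI[of _ "\<Phi>(i := \<Psi>)"] conjI ballI impI allI)
    fix j k z w assume "j \<in> insert i I" "k \<in> insert i I" "j \<noteq> k"
    then show "(\<Phi>(i := \<Psi>)) j z \<bullet> (\<Phi>(i := \<Psi>)) k w = 0"
      by (auto simp: orth orth' \<Phi>(2))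
  qed (use \<Phi> \<Psi> in auto)
qed

section \<open>Congruence with the Takeuchi-Ozeki polynomial\<close>

lemma sum_option:
  fixes f :: "'k::finite option \<Rightarrow> 'b::comm_monoid_add"
  shows "(\<Sum>i\<in>UNIV. f i) = f None + (\<Sum>j\<in>UNIV. f (Some j))"
  by (simp add: UNIV_option_conv sum.reindex)

lemma congruent_level_families:
  fixes T :: "'a::euclidean_space \<Rightarrow> 'b::euclidean_space"
  assumes lin: "linear T" and norm: "\<And>z. norm (T z) = norm z" and dim: "DIM('a) = DIM('b)"
    and FG: "\<And>z. F (T z) = G z"
  shows "congruent_families (level_family F) (level_family G)"
proof -
  have inj: "inj T"
    using lin norm by (metis linear_injective_0 norm_eq_zero)
  then have surj: "surj T"
    using linear_injective_imp_surjective[OF lin] dim by simp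
  \<comment> \<open>\<open>T\<close> runs from the space of \<open>G\<close> to that of
    \<open>F\<close>, so the congruence from the levels of \<open>F\<close> to those of
    \<open>G\<close> is its inverse.\<close>
  define S where "S = inv T"
  have ST: "S (T z) = z" and TS: "T (S w) = w" for z w
    using inj surj by (simp_all add: S_def surj_f_inv_f)
  have "linear S"
    by (rule linearI; rule injD[OF inj]) (simp_all add: TS linear_add[OF lin] linear_scale[OF lin])
  moreover have "bij S"
    unfolding S_def by (intro bij_imp_bij_inv bijI inj surj)
  moreover have inner: "S x \<bullet> S y = x \<bullet> y" for x y
    using inner_linear_isometry[OF lin norm, of "S x" "S y"] by (simp add: TS)
  moreover have "(\<lambda>M. S ` M) ` level_family F = level_family G"
  proof -
    have "S ` {x \<in> sphere 0 1. F x = c} = {x \<in> sphere 0 1. G x = c}" (is "S ` ?A = ?B") for c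
    proof
      show "S ` ?A \<subseteq> ?B" using norm FG TS by auto metis+
      show "?B \<subseteq> S ` ?A"
      proof
        fix z assume "z \<in> ?B"
        then have "T z \<in> ?A" using norm FG by simp
        then show "z \<in> S ` ?A" by (metis ST image_eqI)
      qed
    qed
    then show ?thesis unfolding level_family_def by (simp add: setcompr_eq_image image_image)
  qed
  ultimately show ?thesis unfolding congruent_families_def by blast
qed

text \<open>The argument common to both algebras. \<open>adj\<close> reads the coordinates of u v*
  off as inner products of u with e_a v, and \<open>parseval\<close> recovers the norm of u v* from
  them.\<close>

lemma congruent_TO:
  fixes mul :: "'f::euclidean_space \<Rightarrow> 'f \<Rightarrow> 'f" and P :: "nat \<Rightarrow> 'a::euclidean_space \<Rightarrow> 'a"
  assumes sys: "clifford_system m P" and adm: "admits_frames m P (\<lambda>a. mul (e a))"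
    and dim: "DIM('a) = 2 * DIM('f) * (CARD('k) + 1)"
    and one: "\<And>v. mul (e 0) v = v"
    and lin: "\<And>a. a \<in> {1..m} \<Longrightarrow> linear (mul (e a))"
    and skew: "\<And>a u v. a \<in> {1..m} \<Longrightarrow> mul (e a) u \<bullet> v = - (u \<bullet> mul (e a) v)"
    and adj: "\<And>a u v. a \<le> m \<Longrightarrow> mul u (cj v) \<bullet> e a = u \<bullet> mul (e a) v"
    and parseval: "\<And>h. (norm h)\<^sup>2 = (\<Sum>a\<le>m. (h \<bullet> e a)\<^sup>2)"
  shows "congruent_families (level_family (clifford_poly m P))
     (level_family (TO_poly mul cj :: ('f \<times> ('f ^ 'k)) \<times> ('f \<times> ('f ^ 'k)) \<Rightarrow> real))"
proof -
  \<comment> \<open>The index type \<open>'k option\<close> supplies k + 1 copies;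
    \<open>None\<close> is the distinguished coordinate holding \<open>u\<^sub>0\<close> and
    \<open>v\<^sub>0\<close>.\<close>
  have "2 * DIM('f) * card (UNIV :: 'k option set) \<le> DIM('a)"
    by (simp add: dim UNIV_option_conv card_image)
  from orthogonal_frames[OF sys adm finite this]
  obtain \<Phi> :: "'k option \<Rightarrow> 'f \<times> 'f \<Rightarrow> 'a"
    where frame: "\<And>i. clifford_frame m P (\<lambda>a. mul (e a)) (\<Phi> i)"
      and orth: "\<And>i j z w. i \<noteq> j \<Longrightarrow> \<Phi> i z \<bullet> \<Phi> j w = 0"
    by (metis UNIV_I)
  have lin\<Phi>: "linear (\<Phi> i)" and norm\<Phi>: "norm (\<Phi> i z) = norm z"
    and P0: "P 0 (\<Phi> i (p, q)) = \<Phi> i (p, - q)" 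
    and Pa: "a \<in> {1..m} \<Longrightarrow> P a (\<Phi> i (p, q)) = \<Phi> i (mul (e a) q, - mul (e a) p)" for i z a p q
    using frame[of i] unfolding clifford_frame_def by blast+
  define s :: real where "s = 1 / sqrt 2"
  have s: "s * (s * r) = r / 2" for r by (simp add: s_def)
  \<comment> \<open>At \<open>None\<close>, p = (u_0 + v_0)/sqrt 2 and q = (v_0 - u_0)/sqrt 2
    satisfy |p|^2 - |q|^2 = 2<u_0, v_0>, which is the mixed term in \<open>TO_F0\<close>.\<close>
  define c :: "('f \<times> ('f ^ 'k)) \<times> ('f \<times> ('f ^ 'k)) \<Rightarrow> 'k option \<Rightarrow> 'f \<times> 'f" where
    "c z i = (case i of
       None \<Rightarrow> (s *\<^sub>R (fst (fst z) + fst (snd z)), s *\<^sub>R (fst (snd z) - fst (fst z)))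
     | Some j \<Rightarrow> (snd (fst z) $ j, snd (snd z) $ j))" for z i
  define T where "T z = (\<Sum>i\<in>UNIV. \<Phi> i (c z i))" for z
  \<comment> \<open>Stated for arbitrary \<open>g\<close> because each \<open>P a (T z)\<close> is
    again such a sum over the frames, with other coordinates.\<close>
  have inner_T: "(\<Sum>i\<in>UNIV. \<Phi> i (g i)) \<bullet> T z = (\<Sum>i\<in>UNIV. g i \<bullet> c z i)" for g z
  proof -
    have "(\<Sum>i\<in>UNIV. \<Phi> i (g i)) \<bullet> T z = (\<Sum>i\<in>UNIV. \<Sum>j\<in>UNIV. \<Phi> i (g i) \<bullet> \<Phi> j (c z j))"
      by (simp add: T_def inner_sum_left inner_sum_right) (rule sum.swap)
    also have "\<dots> = (\<Sum>i\<in>UNIV. \<Sum>j\<in>UNIV. if j = i then g i \<bullet> c z i else 0)"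
      by (intro sum.cong refl) (auto simp: orth inner_linear_isometry[OF lin\<Phi> norm\<Phi>])
    finally show ?thesis by simp
  qed
  have c_lin: "c (z + w) i = c z i + c w i" "c (r *\<^sub>R z) i = r *\<^sub>R c z i" for z w r i
    by (auto simp: c_def algebra_simps split: option.split)
  have "linear T"
    by (rule linearI)
      (simp_all add: T_def c_lin linear_add[OF lin\<Phi>] linear_scale[OF lin\<Phi>] sum.distrib scaleR_sum_right)
  have TT: "T z \<bullet> T z = z \<bullet> z" for z
    using inner_T[of "c z" z, folded T_def] unfolding sum_option
    by (simp add: c_def inner_prod_def inner_vec_def inner_simps s sum.distrib inner_commute
        algebra_simps)
  then have "norm (T z) = norm z" for z
    by (simp add: norm_eq_sqrt_inner)
  moreover have "DIM(('f \<times> ('f ^ 'k)) \<times> ('f \<times> ('f ^ 'k))) = DIM('a)"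
    by (simp add: dim algebra_simps)
  moreover have "clifford_poly m P (T z) = TO_poly mul cj z" for z
  proof -
    obtain u\<^sub>0 u\<^sub>1 v\<^sub>0 v\<^sub>1 where z: "z = ((u\<^sub>0, u\<^sub>1), (v\<^sub>0, v\<^sub>1))" by (metis surj_pair)
    define h where "h = herm_prod mul cj (u\<^sub>0, u\<^sub>1) (v\<^sub>0, v\<^sub>1)"
    have h: "h \<bullet> e a = u\<^sub>0 \<bullet> mul (e a) v\<^sub>0 + (\<Sum>j\<in>UNIV. u\<^sub>1 $ j \<bullet> mul (e a) (v\<^sub>1 $ j))" if "a \<le> m" for a
      by (simp add: h_def herm_prod_def inner_add_left inner_sum_left adj that)
    have h0: "h \<bullet> e 0 = (u\<^sub>0, u\<^sub>1) \<bullet> (v\<^sub>0, v\<^sub>1)"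
      by (simp add: h one inner_vec_def)
    have P_T: "P a (T z) = (\<Sum>i\<in>UNIV. P a (\<Phi> i (c z i)))" if "a \<le> m" for a
      unfolding T_def by (rule linear_sum[OF clifford_linear[OF sys that]])
    have T0: "P 0 (T z) \<bullet> T z = (norm u\<^sub>1)\<^sup>2 - (norm v\<^sub>1)\<^sup>2 + 2 * (u\<^sub>0 \<bullet> v\<^sub>0)"
    proof -
      have "P 0 (T z) = (\<Sum>i\<in>UNIV. \<Phi> i (fst (c z i), - snd (c z i)))"
        by (simp add: P_T flip: P0)
      then have "P 0 (T z) \<bullet> T z = (\<Sum>i\<in>UNIV. (fst (c z i), - snd (c z i)) \<bullet> c z i)"
        by (simp only: inner_T)
      then show ?thesis
        unfolding sum_option
        by (simp add: c_def z power2_norm_eq_inner inner_vec_def inner_simps s sum_subtractf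
            inner_commute algebra_simps)
    qed
    have Ta: "P a (T z) \<bullet> T z = 2 * (h \<bullet> e a)" if a: "a \<in> {1..m}" for a
    proof -
      have "P a (T z) = (\<Sum>i\<in>UNIV. \<Phi> i (mul (e a) (snd (c z i)), - mul (e a) (fst (c z i))))"
        using a by (simp add: P_T flip: Pa[OF a])
      moreover have "(mul (e a) q, - mul (e a) p) \<bullet> (p, q) = 2 * (p \<bullet> mul (e a) q)" for p q
        by (simp add: skew[OF a, of p q] inner_commute[of "mul (e a) q" p])
      ultimately have "P a (T z) \<bullet> T z = (\<Sum>i\<in>UNIV. 2 * (fst (c z i) \<bullet> mul (e a) (snd (c z i))))"
        by (simp only: inner_T) (metis prod.collapse)
      also have "\<dots> = (u\<^sub>0 + v\<^sub>0) \<bullet> mul (e a) (v\<^sub>0 - u\<^sub>0) + 2 * (\<Sum>j\<in>UNIV. u\<^sub>1 $ j \<bullet> mul (e a) (v\<^sub>1 $ j))"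
        by (simp add: sum_option c_def z linear_scale[OF lin[OF a]] s sum_distrib_left)
      \<comment> \<open>Skewness removes the two pure terms and makes the two mixed terms equal, so
        the rotation does not disturb the pairing with an imaginary unit.\<close>
      also have "(u\<^sub>0 + v\<^sub>0) \<bullet> mul (e a) (v\<^sub>0 - u\<^sub>0) = 2 * (u\<^sub>0 \<bullet> mul (e a) v\<^sub>0)"
        using skew[OF a, of u\<^sub>0 u\<^sub>0] skew[OF a, of v\<^sub>0 v\<^sub>0] skew[OF a, of u\<^sub>0 v\<^sub>0]
        by (simp add: linear_diff[OF lin[OF a]] inner_simps inner_commute)
      finally show ?thesis
        using a by (simp add: h)
    qed
    have "(\<Sum>i\<le>m. (P i (T z) \<bullet> T z)\<^sup>2) = (P 0 (T z) \<bullet> T z)\<^sup>2 + (\<Sum>a=1..m. (P a (T z) \<bullet> T z)\<^sup>2)"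
      by (simp add: atMost_atLeast0 sum.atLeast_Suc_atMost)
    also have "(\<Sum>a=1..m. (P a (T z) \<bullet> T z)\<^sup>2) = 4 * (\<Sum>a=1..m. (h \<bullet> e a)\<^sup>2)"
      by (simp add: Ta power_mult_distrib sum_distrib_left)
    also have "(\<Sum>a=1..m. (h \<bullet> e a)\<^sup>2) = (norm h)\<^sup>2 - (h \<bullet> e 0)\<^sup>2"
      by (simp add: parseval atMost_atLeast0 sum.atLeast_Suc_atMost)
    finally have "(\<Sum>i\<le>m. (P i (T z) \<bullet> T z)\<^sup>2) = TO_F0 mul cj (u\<^sub>0, u\<^sub>1) (v\<^sub>0, v\<^sub>1)"
      by (simp add: TO_F0_def T0 h0 flip: h_def)
    then show ?thesis
      by (simp add: clifford_poly_def TO_poly_def TT z power2_norm_eq_inner)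
  qed
  ultimately show ?thesis
    by (intro congruent_level_families[OF \<open>linear T\<close>])
qed

section \<open>The quaternionic and octonionic cases\<close>

lemma quat_unit_simps:
  "quat_unit 0 = (1, 0)" "quat_unit (Suc 0) = (\<i>, 0)" "quat_unit 2 = (0, 1)" "quat_unit 3 = (0, \<i>)"
  by (simp_all add: quat_unit_def)

lemma oct_unit_simps:
  "oct_unit 0 = ((1, 0), 0)" "oct_unit (Suc 0) = ((\<i>, 0), 0)" "oct_unit 2 = ((0, 1), 0)"
  "oct_unit 3 = ((0, \<i>), 0)" "oct_unit 4 = (0, (1, 0))" "oct_unit 5 = (0, (\<i>, 0))"
  "oct_unit 6 = (0, (0, 1))" "oct_unit 7 = (0, (0, \<i>))"
  by (simp_all add: oct_unit_def)

lemma congruent_TO_quat: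
  fixes P :: "nat \<Rightarrow> 'a::euclidean_space \<Rightarrow> 'a"
  assumes sys: "clifford_system 3 P" and dim: "DIM('a) = 8 * (CARD('k) + 1)"
  shows "congruent_families (level_family (clifford_poly 3 P))
     (TO_family_quat :: ((quat \<times> (quat ^ 'k)) \<times> (quat \<times> (quat ^ 'k))) set set)"
  unfolding TO_family_quat_def
proof (rule congruent_TO[OF sys admits_frames_quat[OF sys]])
  have cases: "a = 0 \<or> a = 1 \<or> a = 2 \<or> a = 3" if "a \<le> 3" for a :: nat using that by linarith
  show "quat_mult (quat_unit 0) v = v" for v
    by (cases v) (simp add: quat_unit_simps)
  show "linear (quat_mult (quat_unit a))" for a
    by (cases "quat_unit a") (auto intro!: linearI simp: algebra_simps)
  show "quat_mult (quat_unit a) u \<bullet> v = - (u \<bullet> quat_mult (quat_unit a) v)" if "a \<in> {1..3}" for a u v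
    using that unfolding atLeastAtMost_1_3
    by (cases u; cases v) (auto simp: quat_unit_simps inner_complex_def)
  show "quat_mult u (quat_cnj v) \<bullet> quat_unit a = u \<bullet> quat_mult (quat_unit a) v" if "a \<le> 3" for a u v
    using cases[OF that]
    by (cases u; cases v) (auto simp: quat_unit_simps inner_complex_def)
  show "(norm h)\<^sup>2 = (\<Sum>a\<le>3. (h \<bullet> quat_unit a)\<^sup>2)" for h
    unfolding power2_norm_eq_inner
    by (cases h) (simp add: quat_unit_def eval_nat_numeral inner_complex_def)
qed (simp add: dim)

lemma congruent_TO_oct:
  fixes P :: "nat \<Rightarrow> 'a::euclidean_space \<Rightarrow> 'a"
  assumes sys: "clifford_system 7 P" and dim: "DIM('a) = 16 * (CARD('k) + 1)"
  shows "congruent_families (level_family (clifford_poly 7 P))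
     (TO_family_oct :: ((oct \<times> (oct ^ 'k)) \<times> (oct \<times> (oct ^ 'k))) set set)"
  unfolding TO_family_oct_def
proof (rule congruent_TO[OF sys admits_frames_oct[OF sys]])
  have cases: "a = 0 \<or> a = 1 \<or> a = 2 \<or> a = 3 \<or> a = 4 \<or> a = 5 \<or> a = 6 \<or> a = 7"
    if "a \<le> 7" for a :: nat using that by linarith
  have split: "\<exists>a b c d. u = ((a, b), (c, d))" for u :: oct by (metis surj_pair)
  show "oct_mult (oct_unit 0) v = v" for v
    using split[of v] by (auto simp: oct_unit_simps zero_prod_def)
  show "linear (oct_mult (oct_unit a))" for a
    using split[of "oct_unit a"] by (auto intro!: linearI simp: algebra_simps)
  show "oct_mult (oct_unit a) u \<bullet> v = - (u \<bullet> oct_mult (oct_unit a) v)" if "a \<in> {1..7}" for a u v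
    using that split[of u] split[of v] unfolding atLeastAtMost_1_7
    by (auto simp: oct_unit_simps zero_prod_def inner_complex_def)
  show "oct_mult u (oct_cnj v) \<bullet> oct_unit a = u \<bullet> oct_mult (oct_unit a) v" if "a \<le> 7" for a u v
    using cases[OF that] split[of u] split[of v]
    by (elim exE disjE) (simp_all add: oct_unit_simps zero_prod_def inner_complex_def)
  show "(norm h)\<^sup>2 = (\<Sum>a\<le>7. (h \<bullet> oct_unit a)\<^sup>2)" for h
    unfolding power2_norm_eq_inner using split[of h]
    by (auto simp: oct_unit_def eval_nat_numeral inner_complex_def zero_prod_def)
qed (simp add: dim)

theorem theorem5p9:
  fixes k :: nat
  assumes "k \<ge> 1" and "CARD('k::finite) = k"
  shows "(\<forall>\<F> :: (real ^ 'n) set set. clifford_isoparametric_family 3 (4 * k) \<F> \<longrightarrow>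
            congruent_families \<F>
              (TO_family_quat :: ((quat \<times> (quat ^ 'k)) \<times> (quat \<times> (quat ^ 'k))) set set)) \<and>
         (\<forall>\<F> :: (real ^ 'm) set set. clifford_isoparametric_family 7 (8 * k) \<F> \<longrightarrow>
            congruent_families \<F>
              (TO_family_oct :: ((oct \<times> (oct ^ 'k)) \<times> (oct \<times> (oct ^ 'k))) set set))"
proof (intro conjI allI impI)
  fix \<F> :: "(real ^ 'n) set set"
  assume "clifford_isoparametric_family 3 (4 * k) \<F>"
  \<comment> \<open>Here l = 3 + 4k + 1, so 2l = 8(k + 1) is the dimension of exactly k + 1 copies
    of the 8-dimensional module; in the octonionic case 2l = 2(7 + 8k + 1) = 16(k + 1).\<close>
  then obtain P :: "nat \<Rightarrow> real ^ 'n \<Rightarrow> real ^ 'n" where "clifford_system 3 P"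
    "DIM(real ^ 'n) = 8 * (k + 1)" "\<F> = level_family (clifford_poly 3 P)"
    unfolding clifford_isoparametric_family_def by auto
  then show "congruent_families \<F>
      (TO_family_quat :: ((quat \<times> (quat ^ 'k)) \<times> (quat \<times> (quat ^ 'k))) set set)"
    using congruent_TO_quat[where 'k='k] assms(2) by metis
next
  fix \<F> :: "(real ^ 'm) set set"
  assume "clifford_isoparametric_family 7 (8 * k) \<F>"
  then obtain P :: "nat \<Rightarrow> real ^ 'm \<Rightarrow> real ^ 'm" where "clifford_system 7 P"
    "DIM(real ^ 'm) = 16 * (k + 1)" "\<F> = level_family (clifford_poly 7 P)"
    unfolding clifford_isoparametric_family_def by auto
  then show "congruent_families \<F>
      (TO_family_oct :: ((oct \<times> (oct ^ 'k)) \<times> (oct \<times> (oct ^ 'k))) set set)"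
    using congruent_TO_oct[where 'k='k] assms(2) by metis
qed

end
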